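(* The cohomology of the Lie algebra $\mathfrak{so}(3)$ of left-invariant forms is $$\mathrm{H}^0(\mathfrak{so}(3),\mathbb{R})=\mathbb{R},\quad \mathrm{H}^1(\mathfrak{so}(3),\mathbb{R})=0,\quad \mathrm{H}^2(\mathfrak{so}(3),\mathbb{R})=0,\quad \mathrm{H}^3(\mathfrak{so}(3),\mathbb{R})=\mathbb{R}.$$
   Context: $\mathfrak{so}(3)$ is the real Lie algebra of skew-symmetric $3\times3$ matrices. $\mathrm{H}^k(\mathfrak{g},\mathbb{R})$ denotes the cohomology of the complex of left-invariant differential forms on the Lie group (equivalently of alternating forms on $\mathfrak{g}$) with the exterior differential, so that $\mathrm{d}\omega(X,Y)=-\omega([X,Y])$ for a left-invariant one-form $\omega$ and $X,Y\in\mathfrak{g}$. Equalities mean isomorphism of real vector spaces. *)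

theory Defs
  imports "HOL-Analysis.Analysis" "HOL-Algebra.Module" "HOL-Algebra.AbelCoset"
begin

section \<open>Real vector spaces as modules over the field of real numbers\<close>

definition real_field :: "real ring" where
  "real_field = \<lparr>carrier = UNIV, mult = (*), one = 1, zero = 0, add = (+)\<rparr>"

lemma field_real_field: "Ring.field real_field"
proof -
  have "\<exists>y. y + x = 0" for x :: real
    by (rule exI [of _ "- x"]) simp
  then have "cring real_field"
    by (intro cringI abelian_groupI comm_monoidI) (auto simp: real_field_def algebra_simps)
  then show ?thesis
  proof (rule cring.cring_fieldI2)
    show "\<zero>\<^bsub>real_field\<^esub> \<noteq> \<one>\<^bsub>real_field\<^esub>"
      by (simp add: real_field_def)
    fix x assume "x \<in> carrier real_field" "x \<noteq> \<zero>\<^bsub>real_field\<^esub>"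
    then show "\<exists>y\<in>carrier real_field. x \<otimes>\<^bsub>real_field\<^esub> y = \<one>\<^bsub>real_field\<^esub>"
      by (intro bexI [of _ "inverse x"]) (auto simp: real_field_def)
  qed
qed

text \<open>
  The record type of modules extends that of rings; the fields \<open>mult\<close> and \<open>one\<close> play no role
  for a module and are left undefined in the constructions below.
\<close>

definition real_line :: "(real, real) module" where
  "real_line = \<lparr>carrier = UNIV, mult = undefined, one = undefined,
     zero = 0, add = (+), smult = (*)\<rparr>"

definition zero_space :: "(real, real) module" where
  "zero_space = \<lparr>carrier = {0}, mult = undefined, one = undefined,
     zero = 0, add = (+), smult = (*)\<rparr>"

text \<open>A set of real functions with the pointwise operations.\<close>

definition function_space :: "('a \<Rightarrow> real) set \<Rightarrow> (real, 'a \<Rightarrow> real) module" where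
  "function_space S = \<lparr>carrier = S, mult = undefined, one = undefined,
     zero = (\<lambda>_. 0), add = (\<lambda>f g x. f x + g x), smult = (\<lambda>c f x. c * f x)\<rparr>"

text \<open>
  The quotient of a module by a submodule, whose elements are cosets. As for multiplication in
  a quotient ring, a scalar multiple of a coset is saturated by the submodule \<open>B\<close>, so that
  \<open>0\<close> times a coset is \<open>B\<close> rather than the set containing only zero.
\<close>

definition quotient_module :: "('r, 'a) module \<Rightarrow> 'a set \<Rightarrow> ('r, 'a set) module" where
  "quotient_module M B = \<lparr>carrier = a_rcosets\<^bsub>M\<^esub> B, mult = undefined, one = undefined,
     zero = B, add = set_add M, smult = (\<lambda>c X. \<Union>x\<in>X. B +>\<^bsub>M\<^esub> (c \<odot>\<^bsub>M\<^esub> x))\<rparr>"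

definition vs_isomorphic :: "(real, 'a) module \<Rightarrow> (real, 'b) module \<Rightarrow> bool" where
  "vs_isomorphic V W \<longleftrightarrow>
     Module.module real_field V \<and> Module.module real_field W \<and>
     (\<exists>h. bij_betw h (carrier V) (carrier W) \<and>
        (\<forall>x\<in>carrier V. \<forall>y\<in>carrier V. h (x \<oplus>\<^bsub>V\<^esub> y) = h x \<oplus>\<^bsub>W\<^esub> h y) \<and>
        (\<forall>c. \<forall>x\<in>carrier V. h (c \<odot>\<^bsub>V\<^esub> x) = c \<odot>\<^bsub>W\<^esub> h x))"


section \<open>Cohomology of a Lie algebra with trivial real coefficients\<close>

locale lie_algebra =
  fixes g :: "'a::real_vector set" and br :: "'a \<Rightarrow> 'a \<Rightarrow> 'a"
  assumes subspace: "subspace g"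
    and closed: "\<lbrakk>x \<in> g; y \<in> g\<rbrakk> \<Longrightarrow> br x y \<in> g"
    and add_left: "\<lbrakk>x \<in> g; y \<in> g; z \<in> g\<rbrakk> \<Longrightarrow> br (x + y) z = br x z + br y z"
    and add_right: "\<lbrakk>x \<in> g; y \<in> g; z \<in> g\<rbrakk> \<Longrightarrow> br x (y + z) = br x y + br x z"
    and scale_left: "\<lbrakk>x \<in> g; y \<in> g\<rbrakk> \<Longrightarrow> br (c *\<^sub>R x) y = c *\<^sub>R br x y"
    and scale_right: "\<lbrakk>x \<in> g; y \<in> g\<rbrakk> \<Longrightarrow> br x (c *\<^sub>R y) = c *\<^sub>R br x y"
    and alternating: "x \<in> g \<Longrightarrow> br x x = 0"
    and jacobi: "\<lbrakk>x \<in> g; y \<in> g; z \<in> g\<rbrakk>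
      \<Longrightarrow> br x (br y z) + br y (br z x) + br z (br x y) = 0"

definition tuples :: "'a set \<Rightarrow> nat \<Rightarrow> 'a list set" where
  "tuples g k = {xs. length xs = k \<and> set xs \<subseteq> g}"

text \<open>
  A \<open>k\<close>-form on \<open>g\<close> takes a list of \<open>k\<close> vectors of \<open>g\<close>. It is extended by zero to all other
  lists, which makes equality of forms on \<open>g\<close> equality of functions.
\<close>

definition alt_forms :: "'a::real_vector set \<Rightarrow> nat \<Rightarrow> ('a list \<Rightarrow> real) set" where
  "alt_forms g k = {\<omega>.
     (\<forall>xs. xs \<notin> tuples g k \<longrightarrow> \<omega> xs = 0) \<and>
     (\<forall>xs\<in>tuples g k. \<forall>i<k. \<forall>x\<in>g. \<forall>y\<in>g.
        \<omega> (xs[i := x + y]) = \<omega> (xs[i := x]) + \<omega> (xs[i := y])) \<and>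
     (\<forall>xs\<in>tuples g k. \<forall>i<k. \<forall>c. \<forall>x\<in>g.
        \<omega> (xs[i := c *\<^sub>R x]) = c * \<omega> (xs[i := x])) \<and>
     (\<forall>xs\<in>tuples g k. \<forall>i<k. \<forall>j<k. i \<noteq> j \<and> xs ! i = xs ! j \<longrightarrow> \<omega> xs = 0)}"

text \<open>
  The exterior differential of a left-invariant \<open>k\<close>-form, in terms of the bracket:
  \<open>d\<omega>(x\<^sub>0,\<dots>,x\<^sub>k) = \<Sum>i<j. (-1)\<^sup>i\<^sup>+\<^sup>j \<omega>([x\<^sub>i,x\<^sub>j],x\<^sub>0,\<dots>,x\<^sub>k)\<close>, where \<open>x\<^sub>i\<close> and \<open>x\<^sub>j\<close> are omitted
  after the bracket. The remaining terms of the invariant formula for the exterior derivative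
  vanish, because a left-invariant form has constant values on left-invariant vector fields.
\<close>

definition form_diff ::
  "'a set \<Rightarrow> ('a \<Rightarrow> 'a \<Rightarrow> 'a) \<Rightarrow> nat \<Rightarrow> ('a list \<Rightarrow> real) \<Rightarrow> 'a list \<Rightarrow> real" where
  "form_diff g br k \<omega> = (\<lambda>xs. if xs \<in> tuples g (Suc k)
     then \<Sum>j\<le>k. \<Sum>i<j. (-1) ^ (i + j) * \<omega> (br (xs ! i) (xs ! j) # nths xs (- {i, j}))
     else 0)"

lemma form_diff_one_form:
  assumes "X \<in> g" and "Y \<in> g"
  shows "form_diff g br 1 \<omega> [X, Y] = - \<omega> [br X Y]"
  using assms by (simp add: form_diff_def tuples_def nths_Cons)

definition cocycles ::
  "'a::real_vector set \<Rightarrow> ('a \<Rightarrow> 'a \<Rightarrow> 'a) \<Rightarrow> nat \<Rightarrow> ('a list \<Rightarrow> real) set" where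
  "cocycles g br k = {\<omega> \<in> alt_forms g k. form_diff g br k \<omega> = (\<lambda>_. 0)}"

fun coboundaries ::
  "'a::real_vector set \<Rightarrow> ('a \<Rightarrow> 'a \<Rightarrow> 'a) \<Rightarrow> nat \<Rightarrow> ('a list \<Rightarrow> real) set" where
  "coboundaries g br 0 = {\<lambda>_. 0}"
| "coboundaries g br (Suc k) = form_diff g br k ` alt_forms g k"

definition lie_cohomology ::
  "'a::real_vector set \<Rightarrow> ('a \<Rightarrow> 'a \<Rightarrow> 'a) \<Rightarrow> nat \<Rightarrow> (real, ('a list \<Rightarrow> real) set) module" where
  "lie_cohomology g br k =
     quotient_module (function_space (cocycles g br k)) (coboundaries g br k)"


section \<open>The Lie algebra of skew-symmetric \<open>3 \<times> 3\<close> matrices\<close>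

definition so3 :: "(real ^ 3 ^ 3) set" where
  "so3 = {A. transpose A = - A}"

definition commutator :: "real ^ 'n ^ 'n \<Rightarrow> real ^ 'n ^ 'n \<Rightarrow> real ^ 'n ^ 'n" where
  "commutator A B = A ** B - B ** A"

lemma lie_algebra_so3: "lie_algebra so3 commutator"
proof
  have tr: "transpose 0 = 0" "transpose (x + y) = transpose x + transpose y"
    "transpose (x - y) = transpose x - transpose y" "transpose (c *\<^sub>R x) = c *\<^sub>R transpose x"
    for c and x y :: "real ^ 3 ^ 3"
    by (simp_all add: transpose_def vec_eq_iff)
  show "subspace so3"
    by (simp add: subspace_def so3_def tr)
  have mm: "(A ** B) $ i $ j = (\<Sum>k\<in>UNIV. A $ i $ k * B $ k $ j)"
    for A B :: "real ^ 3 ^ 3" and i j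
    by (simp add: matrix_matrix_mult_def)
  note entries = commutator_def vec_eq_iff mm sum_3 algebra_simps
  show "commutator x y \<in> so3" if "x \<in> so3" "y \<in> so3" for x y
  proof -
    have "(- y) ** (- x) = y ** x" "(- x) ** (- y) = x ** y"
      by (simp_all add: vec_eq_iff mm)
    with that show ?thesis
      by (simp add: so3_def commutator_def matrix_transpose_mul tr)
  qed
  show "commutator (x + y) z = commutator x z + commutator y z" for x y z :: "real ^ 3 ^ 3"
    by (simp add: entries)
  show "commutator x (y + z) = commutator x y + commutator x z" for x y z :: "real ^ 3 ^ 3"
    by (simp add: entries)
  show "commutator (c *\<^sub>R x) y = c *\<^sub>R commutator x y" for c and x y :: "real ^ 3 ^ 3"
    by (simp add: entries)
  show "commutator x (c *\<^sub>R y) = c *\<^sub>R commutator x y" for c and x y :: "real ^ 3 ^ 3"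
    by (simp add: entries)
  show "commutator x x = 0" for x :: "real ^ 3 ^ 3"
    by (simp add: commutator_def)
  show "commutator x (commutator y z) + commutator y (commutator z x)
      + commutator z (commutator x y) = 0" for x y z :: "real ^ 3 ^ 3"
    by (simp add: entries)
qed

end

theory Submission
  imports Defs
begin

text \<open>
  The rotation algebra is \<open>\<real>\<^sup>3\<close> with the cross product: a vector \<open>x\<close> corresponds to the
  skew-symmetric matrix \<open>hat x\<close> of the map \<open>y \<mapsto> x \<times> y\<close>, and \<open>hat\<close> turns cross products into
  commutators (\<open>commutator_hat\<close>). On \<open>\<real>\<^sup>3\<close> an alternating form is given in degree 0 by a constant,
  in degree 1 by \<open>a \<bullet> x\<close>, in degree 2 by \<open>a \<bullet> (x \<times> y)\<close> and in degree 3 by \<open>c (x \<bullet> (y \<times> z))\<close>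
  (\<open>alt_forms_0\<close> to \<open>alt_forms_3\<close>).

  In these coordinates the complex reads \<open>\<real> \<rightarrow> \<real>\<^sup>3 \<rightarrow> \<real>\<^sup>3 \<rightarrow> \<real>\<close>. The first differential vanishes
  because the coefficients are trivial. The second is \<open>a \<mapsto> - a\<close>, because the form \<open>a \<bullet> x\<close> on a
  bracket is \<open>a \<bullet> (x \<times> y)\<close> (\<open>form_diff_one_form_eq\<close>). The third vanishes by the Jacobi identity
  of the cross product (\<open>form_diff_two_form_eq\<close>), and a 3-form is closed by an identity for products
  of four vectors (\<open>form_diff_three_form_eq\<close>). The isomorphism in the middle cancels the
  two copies of \<open>\<real>\<^sup>3\<close>, and a line survives at either end.

  To pass from such a description to an isomorphism with the quotient of cocycles by coboundaries,
  it suffices to name a linear functional on the cocycles whose kernel consists of the coboundaries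
  (\<open>quotient_by_kernel\<close>): evaluation at one tuple in degrees 0 and 3, zero in degrees 1 and 2.
\<close>

section \<open>Quotients by the kernel of a linear functional\<close>

lemma cring_real_field: "cring real_field"
  using field_real_field by (simp add: Ring.field_def domain_def)

text \<open>
  Transport of structure: the carrier of \<open>V\<close> need not be known to be a module beforehand, since a
  bijection from a module \<open>W\<close> that respects the operations carries the module laws over to \<open>V\<close>.
  For cosets this is far easier than checking the laws on sets.
\<close>

lemma module_transfer:
  fixes V :: "(real, 'a) module" and W :: "(real, 'b) module"
  assumes W: "Module.module real_field W"
    and bij: "bij_betw g (carrier W) (carrier V)"
    and add: "\<And>s t. \<lbrakk>s \<in> carrier W; t \<in> carrier W\<rbrakk> \<Longrightarrow> g s \<oplus>\<^bsub>V\<^esub> g t = g (s \<oplus>\<^bsub>W\<^esub> t)"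
    and smult: "\<And>c s. s \<in> carrier W \<Longrightarrow> c \<odot>\<^bsub>V\<^esub> g s = g (c \<odot>\<^bsub>W\<^esub> s)"
    and zero: "\<zero>\<^bsub>V\<^esub> = g \<zero>\<^bsub>W\<^esub>"
  shows "vs_isomorphic V W"
proof -
  interpret W: Module.module real_field W by (rule W)
  have carrier_V: "carrier V = g ` carrier W"
    using bij by (simp add: bij_betw_def)
  have inj: "inj_on g (carrier W)"
    using bij by (simp add: bij_betw_def)
  have R: "c \<in> carrier real_field" for c
    by (simp add: real_field_def)
  have V: "Module.module real_field V"
  proof (rule moduleI)
    show "cring real_field" by (rule cring_real_field)
    show "abelian_group V"
    proof (rule abelian_groupI)
      show "\<exists>y\<in>carrier V. y \<oplus>\<^bsub>V\<^esub> x = \<zero>\<^bsub>V\<^esub>" if "x \<in> carrier V" for x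
      proof -
        from that obtain s where s: "s \<in> carrier W" "x = g s"
          unfolding carrier_V by blast
        show ?thesis
          by (rule bexI [of _ "g (\<ominus>\<^bsub>W\<^esub> s)"]) (auto simp: s carrier_V add zero W.l_neg)
      qed
    qed (auto simp: carrier_V add zero W.a_ac)
  qed (use R in \<open>auto simp: carrier_V add smult W.smult_l_distr W.smult_r_distr W.smult_assoc1\<close>)
  let ?h = "inv_into (carrier W) g"
  have "bij_betw ?h (carrier V) (carrier W)"
    by (rule bij_betw_inv_into [OF bij])
  then show ?thesis
    unfolding vs_isomorphic_def using V W R
    by (intro conjI exI [of _ ?h]) (auto simp: carrier_V add smult inv_into_f_f [OF inj])
qed

lemma module_real_subspace:
  assumes "subspace T"
  shows "Module.module real_field (real_line\<lparr>carrier := T\<rparr>)"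
proof (rule moduleI)
  show "cring real_field" by (rule cring_real_field)
  show "abelian_group (real_line\<lparr>carrier := T\<rparr>)"
  proof (rule abelian_groupI)
    show "\<exists>y\<in>carrier (real_line\<lparr>carrier := T\<rparr>).
        y \<oplus>\<^bsub>real_line\<lparr>carrier := T\<rparr>\<^esub> x = \<zero>\<^bsub>real_line\<lparr>carrier := T\<rparr>\<^esub>"
      if "x \<in> carrier (real_line\<lparr>carrier := T\<rparr>)" for x
      using that subspace_neg [OF assms]
      by (intro bexI [of _ "- x"]) (auto simp: real_line_def)
  qed (use assms in \<open>auto simp: real_line_def subspace_def\<close>)
qed (use assms in \<open>auto simp: real_line_def real_field_def subspace_def algebra_simps\<close>)

text \<open>
  The first isomorphism theorem for a functional \<open>\<phi>\<close> on a space of functions. The cosets of the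
  kernel are the level sets of \<open>\<phi>\<close>, so the values of \<open>\<phi>\<close> label the elements of the quotient, and
  sums and multiples of level sets are the level sets of the sums and multiples of the labels.
\<close>

lemma quotient_by_kernel:
  fixes S :: "('a \<Rightarrow> real) set" and \<phi> :: "('a \<Rightarrow> real) \<Rightarrow> real"
  assumes S_zero: "(\<lambda>_. 0) \<in> S"
    and S_add: "\<And>f h. \<lbrakk>f \<in> S; h \<in> S\<rbrakk> \<Longrightarrow> (\<lambda>x. f x + h x) \<in> S"
    and S_scale: "\<And>c f. f \<in> S \<Longrightarrow> (\<lambda>x. c * f x) \<in> S"
    and \<phi>_add: "\<And>f h. \<lbrakk>f \<in> S; h \<in> S\<rbrakk> \<Longrightarrow> \<phi> (\<lambda>x. f x + h x) = \<phi> f + \<phi> h"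
    and \<phi>_scale: "\<And>c f. f \<in> S \<Longrightarrow> \<phi> (\<lambda>x. c * f x) = c * \<phi> f"
    and B: "B = {f \<in> S. \<phi> f = 0}"
  shows "vs_isomorphic (quotient_module (function_space S) B) (real_line\<lparr>carrier := \<phi> ` S\<rparr>)"
proof -
  let ?M = "function_space S" and ?Q = "quotient_module (function_space S) B"
  have \<phi>_zero: "\<phi> (\<lambda>_. 0) = 0"
    using \<phi>_scale [OF S_zero, of 0] by simp
  define level where "level t = {f \<in> S. \<phi> f = t}" for t
  have diff: "(\<lambda>x. f x - h x) \<in> S" "\<phi> (\<lambda>x. f x - h x) = \<phi> f - \<phi> h"
    if "f \<in> S" "h \<in> S" for f h
    using S_add [OF that(1) S_scale [OF that(2), of "-1"]]
      \<phi>_add [OF that(1) S_scale [OF that(2), of "-1"]] \<phi>_scale [OF that(2), of "-1"]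
    by simp_all
  have coset: "B +>\<^bsub>?M\<^esub> f = level (\<phi> f)" if f: "f \<in> S" for f
  proof (intro equalityI subsetI)
    show "h \<in> level (\<phi> f)" if "h \<in> B +>\<^bsub>?M\<^esub> f" for h
      using that f
      by (auto simp: a_r_coset_def' function_space_def B level_def S_add \<phi>_add)
    show "h \<in> B +>\<^bsub>?M\<^esub> f" if "h \<in> level (\<phi> f)" for h
    proof -
      have "(\<lambda>x. h x - f x) \<in> B"
        using that f diff by (auto simp: level_def B)
      then show ?thesis
        by (force simp: a_r_coset_def' function_space_def)
    qed
  qed
  have carrier_Q: "carrier ?Q = level ` \<phi> ` S"
  proof -
    have "carrier ?M = S"
      by (simp add: function_space_def)
    then show ?thesis
      by (auto simp: quotient_module_def A_RCOSETS_def' coset)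
  qed
  have inj: "inj_on level (\<phi> ` S)"
    by (auto simp: inj_on_def level_def set_eq_iff)
  have T: "subspace (\<phi> ` S)"
    unfolding subspace_def
  proof (intro conjI ballI allI)
    show "0 \<in> \<phi> ` S" using \<phi>_zero S_zero by force
    show "s + t \<in> \<phi> ` S" if "s \<in> \<phi> ` S" "t \<in> \<phi> ` S" for s t
      using that S_add \<phi>_add by (metis (no_types, lifting) image_iff)
    show "c *\<^sub>R s \<in> \<phi> ` S" if "s \<in> \<phi> ` S" for c s
      using that S_scale \<phi>_scale by (metis (no_types, lifting) image_iff real_scaleR_def)
  qed
  show ?thesis
  proof (rule module_transfer [where g = level])
    show "Module.module real_field (real_line\<lparr>carrier := \<phi> ` S\<rparr>)"
      by (rule module_real_subspace [OF T])
    show "bij_betw level (carrier (real_line\<lparr>carrier := \<phi> ` S\<rparr>)) (carrier ?Q)"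
      using inj by (simp add: bij_betw_def carrier_Q)
    show "\<zero>\<^bsub>?Q\<^esub> = level \<zero>\<^bsub>real_line\<lparr>carrier := \<phi> ` S\<rparr>\<^esub>"
      by (simp add: quotient_module_def real_line_def level_def B)
    show "level s \<oplus>\<^bsub>?Q\<^esub> level t = level (s \<oplus>\<^bsub>real_line\<lparr>carrier := \<phi> ` S\<rparr>\<^esub> t)"
      if "s \<in> carrier (real_line\<lparr>carrier := \<phi> ` S\<rparr>)"
        and "t \<in> carrier (real_line\<lparr>carrier := \<phi> ` S\<rparr>)" for s t
    proof -
      obtain f where f: "f \<in> S" "\<phi> f = s" using \<open>s \<in> _\<close> by auto
      have "k \<in> level s <+>\<^bsub>?M\<^esub> level t" if k: "k \<in> S" "\<phi> k = s + t" for k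
      proof -
        have "f \<in> level s" "(\<lambda>x. k x - f x) \<in> level t"
          using f k diff by (auto simp: level_def)
        then show ?thesis
          by (force simp: set_add_def' function_space_def)
      qed
      moreover have "level s <+>\<^bsub>?M\<^esub> level t \<subseteq> level (s + t)"
        by (auto simp: set_add_def' function_space_def level_def S_add \<phi>_add)
      ultimately have "level s <+>\<^bsub>?M\<^esub> level t = level (s + t)"
        by (auto simp: level_def)
      then show ?thesis
        by (simp add: quotient_module_def real_line_def)
    qed
    show "c \<odot>\<^bsub>?Q\<^esub> level s = level (c \<odot>\<^bsub>real_line\<lparr>carrier := \<phi> ` S\<rparr>\<^esub> s)"
      if "s \<in> carrier (real_line\<lparr>carrier := \<phi> ` S\<rparr>)" for c s
    proof -
      have ne: "level s \<noteq> {}"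
        using that by (auto simp: level_def)
      have "c \<odot>\<^bsub>?Q\<^esub> level s = (\<Union>f\<in>level s. B +>\<^bsub>?M\<^esub> (\<lambda>x. c * f x))"
        by (simp add: quotient_module_def function_space_def)
      also have "\<dots> = (\<Union>f\<in>level s. level (c * s))"
        by (rule SUP_cong) (auto simp: level_def coset S_scale \<phi>_scale)
      also have "\<dots> = level (c * s)"
        using ne by simp
      finally show ?thesis
        by (simp add: real_line_def)
    qed
  qed
qed

lemma real_line_carrier_UNIV: "real_line\<lparr>carrier := UNIV\<rparr> = real_line"
  and real_line_carrier_zero: "real_line\<lparr>carrier := {0}\<rparr> = zero_space"
  by (simp_all add: real_line_def zero_space_def)


section \<open>Alternating forms\<close>

lemma alt_forms_zero: "(\<lambda>_. 0) \<in> alt_forms g k"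
  by (simp add: alt_forms_def)

lemma alt_forms_add:
  "\<lbrakk>\<omega> \<in> alt_forms g k; \<eta> \<in> alt_forms g k\<rbrakk> \<Longrightarrow> (\<lambda>xs. \<omega> xs + \<eta> xs) \<in> alt_forms g k"
  unfolding alt_forms_def mem_Collect_eq
  by (elim conjE, intro conjI) (auto simp: distrib_left)

lemma alt_forms_scale: "\<omega> \<in> alt_forms g k \<Longrightarrow> (\<lambda>xs. c * \<omega> xs) \<in> alt_forms g k"
  unfolding alt_forms_def mem_Collect_eq
  by (elim conjE, intro conjI) (auto simp: distrib_left)

text \<open>
  In the definition of an alternating form, a slot is selected by updating a list. Splitting the
  list at the slot instead is what applies to lists given by their entries.
\<close>

lemma alt_form_slot_add:
  assumes "\<omega> \<in> alt_forms g (Suc (length us + length vs))" "set (us @ vs) \<subseteq> g" "x \<in> g" "y \<in> g"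
  shows "\<omega> (us @ (x + y) # vs) = \<omega> (us @ x # vs) + \<omega> (us @ y # vs)"
proof -
  have "us @ x # vs \<in> tuples g (Suc (length us + length vs))"
    using assms by (simp add: tuples_def)
  moreover have "length us < Suc (length us + length vs)" by simp
  ultimately have "\<omega> ((us @ x # vs)[length us := x + y])
      = \<omega> ((us @ x # vs)[length us := x]) + \<omega> ((us @ x # vs)[length us := y])"
    using assms(1,3,4) unfolding alt_forms_def by blast
  then show ?thesis by simp
qed

lemma alt_form_slot_scale:
  assumes "\<omega> \<in> alt_forms g (Suc (length us + length vs))" "set (us @ vs) \<subseteq> g" "x \<in> g"
  shows "\<omega> (us @ (c *\<^sub>R x) # vs) = c * \<omega> (us @ x # vs)"
proof -
  have "us @ x # vs \<in> tuples g (Suc (length us + length vs))"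
    using assms by (simp add: tuples_def)
  moreover have "length us < Suc (length us + length vs)" by simp
  ultimately have "\<omega> ((us @ x # vs)[length us := c *\<^sub>R x])
      = c * \<omega> ((us @ x # vs)[length us := x])"
    using assms(1,3) unfolding alt_forms_def by blast
  then show ?thesis by simp
qed

lemma alt_form_repeated:
  assumes "\<omega> \<in> alt_forms g k" "set xs \<subseteq> g" "length xs = k" "\<not> distinct xs"
  shows "\<omega> xs = 0"
  using assms unfolding alt_forms_def distinct_conv_nth tuples_def by blast

lemma alt_form_outside: "\<lbrakk>\<omega> \<in> alt_forms g k; xs \<notin> tuples g k\<rbrakk> \<Longrightarrow> \<omega> xs = 0"
  by (simp add: alt_forms_def)


section \<open>Skew-symmetric matrices as vectors with the cross product\<close>

text \<open>
  The matrix of \<open>y \<mapsto> x \<times> y\<close>, and the vector that is recovered from such a matrix, called its axial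
  vector.
\<close>

definition hat :: "real ^ 3 \<Rightarrow> real ^ 3 ^ 3" where
  "hat x = vector [vector [0, - x $ 3, x $ 2], vector [x $ 3, 0, - x $ 1], vector [- x $ 2, x $ 1, 0]]"

definition axial :: "real ^ 3 ^ 3 \<Rightarrow> real ^ 3" where
  "axial A = vector [A $ 3 $ 2, A $ 1 $ 3, A $ 2 $ 1]"

lemma axial_hat [simp]: "axial (hat x) = x"
  by (simp add: axial_def hat_def vec_eq_iff forall_3)

lemma hat_in_so3 [simp]: "hat x \<in> so3"
  by (simp add: so3_def hat_def vec_eq_iff forall_3 transpose_def)

lemma hat_axial:
  assumes "A \<in> so3"
  shows "hat (axial A) = A"
proof -
  have "transpose A = - A"
    using assms by (simp add: so3_def)
  moreover have "transpose A $ i $ j = A $ j $ i" "(- A) $ i $ j = - A $ i $ j" for i j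
    by (simp_all add: transpose_def)
  ultimately have skew: "A $ j $ i = - A $ i $ j" for i j
    by metis
  have diag: "A $ i $ i = 0" for i
    using skew [of i i] by linarith
  show ?thesis
    by (simp add: axial_def hat_def vec_eq_iff forall_3 diag
        skew [of 2 1] skew [of 1 3] skew [of 3 2])
qed

lemma linear_hat: "linear hat"
  by (rule linearI) (simp_all add: hat_def vec_eq_iff forall_3)

lemma linear_axial: "linear axial"
  by (rule linearI) (simp_all add: axial_def vec_eq_iff forall_3)

lemma commutator_hat: "commutator (hat x) (hat y) = hat (cross3 x y)"
  by (simp add: commutator_def hat_def vec_eq_iff forall_3 matrix_matrix_mult_def sum_3
      cross3_def algebra_simps)

text \<open>
  In this lemma and the next, the coefficient vector is written out as the values on the standard
  basis, because the argument for trilinear forms needs to know these values.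
\<close>

lemma linear_functional_eq_inner:
  fixes f :: "real ^ 3 \<Rightarrow> real"
  assumes "linear f"
  shows "f x = vector [f (axis 1 1), f (axis 2 1), f (axis 3 1)] \<bullet> x"
proof -
  have "x = x $ 1 *\<^sub>R axis 1 1 + x $ 2 *\<^sub>R axis 2 1 + x $ 3 *\<^sub>R axis 3 1"
    by (simp add: vec_eq_iff forall_3 axis_def)
  then have "f x = f (x $ 1 *\<^sub>R axis 1 1 + x $ 2 *\<^sub>R axis 2 1 + x $ 3 *\<^sub>R axis 3 1)"
    by (rule arg_cong)
  also have "\<dots> = x $ 1 * f (axis 1 1) + x $ 2 * f (axis 2 1) + x $ 3 * f (axis 3 1)"
    using assms by (simp add: linear_add linear_cmul)
  finally show ?thesis
    by (simp add: inner_vec_def sum_3 mult.commute)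
qed

text \<open>
  Both sides are alternating bilinear, hence determined by the three pairs of distinct basis vectors,
  and the cross products of these pairs are, up to sign, the three basis vectors.
\<close>

lemma alternating_bilinear_eq_cross:
  fixes f :: "real ^ 3 \<Rightarrow> real ^ 3 \<Rightarrow> real"
  assumes l: "\<And>y. linear (\<lambda>x. f x y)" and r: "\<And>x. linear (f x)" and alt: "\<And>x. f x x = 0"
  shows "f x y = vector [f (axis 2 1) (axis 3 1), f (axis 3 1) (axis 1 1), f (axis 1 1) (axis 2 1)]
    \<bullet> cross3 x y"
proof -
  have skew: "f u v = - f v u" for u v
  proof -
    have "f (u + v) (u + v) = f u v + f v u"
      by (simp only: linear_add [OF l] linear_add [OF r]) (simp add: alt)
    then show ?thesis
      by (simp add: alt)
  qed
  have comps: "f x (axis 1 1) = x $ 3 * f (axis 3 1) (axis 1 1) - x $ 2 * f (axis 1 1) (axis 2 1)"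
    "f x (axis 2 1) = x $ 1 * f (axis 1 1) (axis 2 1) - x $ 3 * f (axis 2 1) (axis 3 1)"
    "f x (axis 3 1) = x $ 2 * f (axis 2 1) (axis 3 1) - x $ 1 * f (axis 3 1) (axis 1 1)"
    using linear_functional_eq_inner [OF l, of x "axis 1 1"]
      linear_functional_eq_inner [OF l, of x "axis 2 1"]
      linear_functional_eq_inner [OF l, of x "axis 3 1"]
      skew [of "axis 2 1" "axis 1 1"] skew [of "axis 3 1" "axis 2 1"] skew [of "axis 1 1" "axis 3 1"]
    by (simp_all add: inner_vec_def sum_3 alt mult.commute)
  have "f x y = vector [f x (axis 1 1), f x (axis 2 1), f x (axis 3 1)] \<bullet> y"
    by (rule linear_functional_eq_inner [OF r])
  then show ?thesis
    by (simp add: comps inner_vec_def sum_3 cross_components algebra_simps)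
qed


section \<open>Alternating forms in coordinates\<close>

text \<open>
  A function of vectors in \<open>\<real>\<^sup>3\<close>, pulled back to lists of \<open>k\<close> skew-symmetric matrices and extended
  by zero to other lists, as the equality of forms requires.
\<close>

definition axial_form :: "nat \<Rightarrow> ((real ^ 3) list \<Rightarrow> real) \<Rightarrow> (real ^ 3 ^ 3) list \<Rightarrow> real" where
  "axial_form k f As = (if As \<in> tuples so3 k then f (map axial As) else 0)"

definition const_form where "const_form c = axial_form 0 (\<lambda>_. c)"
definition one_form where "one_form a = axial_form 1 (\<lambda>xs. a \<bullet> (xs ! 0))"
definition two_form where "two_form a = axial_form 2 (\<lambda>xs. a \<bullet> cross3 (xs ! 0) (xs ! 1))"
definition three_form where
  "three_form c = axial_form 3 (\<lambda>xs. c * (xs ! 0 \<bullet> cross3 (xs ! 1) (xs ! 2)))"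

text \<open>
  As \<open>hat\<close> maps onto the skew-symmetric matrices, a form is determined by its values on lists
  \<open>map hat xs\<close>. This reduces every identity between forms to vector algebra.
\<close>

lemma eq_axial_formI:
  assumes "\<And>As. As \<notin> tuples so3 k \<Longrightarrow> \<omega> As = 0"
    and "\<And>xs. length xs = k \<Longrightarrow> \<omega> (map hat xs) = f xs"
  shows "\<omega> = axial_form k f"
proof
  fix As
  show "\<omega> As = axial_form k f As"
  proof (cases "As \<in> tuples so3 k")
    case True
    then have "map hat (map axial As) = As"
      by (auto simp: tuples_def hat_axial intro!: map_idI)
    moreover have "length (map axial As) = k"
      using True by (simp add: tuples_def)
    ultimately show ?thesis
      using assms(2) [of "map axial As"] True by (metis axial_form_def)
  qed (simp add: assms(1) axial_form_def)
qed

lemma linear_alt_form_slot: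
  assumes "\<omega> \<in> alt_forms so3 (Suc (length us + length vs))" "set (us @ vs) \<subseteq> so3"
  shows "linear (\<lambda>x. \<omega> (us @ hat x # vs))"
proof (rule linearI)
  show "\<omega> (us @ hat (x + y) # vs) = \<omega> (us @ hat x # vs) + \<omega> (us @ hat y # vs)" for x y
    using alt_form_slot_add [OF assms] by (simp add: linear_add [OF linear_hat])
  show "\<omega> (us @ hat (c *\<^sub>R x) # vs) = c *\<^sub>R \<omega> (us @ hat x # vs)" for c x
    using alt_form_slot_scale [OF assms] by (simp add: linear_cmul [OF linear_hat])
qed

lemmas so3_closed =
  subspace_add [OF lie_algebra.subspace [OF lie_algebra_so3]]
  subspace_scale [OF lie_algebra.subspace [OF lie_algebra_so3]]

lemma axial_form_alt:
  assumes add: "\<And>xs i x y. \<lbrakk>length xs = k; i < k\<rbrakk> \<Longrightarrow> f (xs[i := x + y]) = f (xs[i := x]) + f (xs[i := y])"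
    and scale: "\<And>xs i c x. \<lbrakk>length xs = k; i < k\<rbrakk> \<Longrightarrow> f (xs[i := c *\<^sub>R x]) = c * f (xs[i := x])"
    and alt: "\<And>xs i j. \<lbrakk>length xs = k; i < j; j < k; xs ! i = xs ! j\<rbrakk> \<Longrightarrow> f xs = 0"
  shows "axial_form k f \<in> alt_forms so3 k"
proof -
  have upd: "axial_form k f (As[i := A]) = f ((map axial As)[i := axial A])"
    if "As \<in> tuples so3 k" "A \<in> so3" for As i A
  proof -
    have "As[i := A] \<in> tuples so3 k"
      using that set_update_subset_insert [of As i A] by (auto simp: tuples_def)
    then show ?thesis
      by (simp add: axial_form_def map_update)
  qed
  have len: "length As = k" if "As \<in> tuples so3 k" for As
    using that by (simp add: tuples_def)
  show ?thesis
    unfolding alt_forms_def mem_Collect_eq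
  proof (intro conjI ballI allI impI)
    fix As i j assume As: "As \<in> tuples so3 k" and ij: "i < k" "j < k" "i \<noteq> j \<and> As ! i = As ! j"
    have "map axial As ! i = map axial As ! j"
      using len [OF As] ij by simp
    then have "f (map axial As) = 0"
      using alt [of "map axial As" i j] alt [of "map axial As" j i] len [OF As] ij
      by (cases i j rule: linorder_cases) auto
    then show "axial_form k f As = 0"
      by (simp add: axial_form_def)
  qed (simp_all add: axial_form_def [of k f] upd [unfolded axial_form_def] so3_closed add scale len
      linear_add [OF linear_axial] linear_cmul [OF linear_axial])
qed

lemma const_form_alt: "const_form c \<in> alt_forms so3 0"
  unfolding const_form_def by (rule axial_form_alt) auto

lemma one_form_alt: "one_form a \<in> alt_forms so3 1"
  unfolding one_form_def by (rule axial_form_alt) (auto simp: inner_add_right)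

lemma two_form_alt: "two_form a \<in> alt_forms so3 2"
  unfolding two_form_def
  by (rule axial_form_alt)
    (auto simp: numeral_2_eq_2 less_Suc_eq inner_add_right
      cross_add_left cross_add_right cross_mult_left cross_mult_right)

lemma three_form_alt: "three_form c \<in> alt_forms so3 3"
  unfolding three_form_def
  by (rule axial_form_alt)
    (auto simp: numeral_3_eq_3 numeral_2_eq_2 less_Suc_eq inner_add_right inner_add_left
      cross_add_left cross_add_right cross_mult_left cross_mult_right dot_cross_self distrib_left)

lemma alt_forms_0: "alt_forms so3 0 = range const_form"
proof (intro equalityI subsetI)
  fix \<omega> :: "(real ^ 3 ^ 3) list \<Rightarrow> real" assume "\<omega> \<in> alt_forms so3 0"
  then have "\<omega> = const_form (\<omega> [])"
    unfolding const_form_def by (intro eq_axial_formI) (auto simp: alt_form_outside)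
  then show "\<omega> \<in> range const_form" by blast
qed (auto simp: const_form_alt)

lemma alt_forms_1: "alt_forms so3 1 = range one_form"
proof (intro equalityI subsetI)
  fix \<omega> :: "(real ^ 3 ^ 3) list \<Rightarrow> real" assume \<omega>: "\<omega> \<in> alt_forms so3 1"
  have "linear (\<lambda>x. \<omega> [hat x])"
    using linear_alt_form_slot [of \<omega> "[]" "[]"] \<omega> by simp
  from linear_functional_eq_inner [OF this] obtain a where "\<And>x. \<omega> [hat x] = a \<bullet> x"
    by blast
  then have "\<omega> = one_form a"
    unfolding one_form_def using \<omega>
    by (intro eq_axial_formI) (auto simp: alt_form_outside length_Suc_conv)
  then show "\<omega> \<in> range one_form" by blast
qed (auto simp: one_form_alt simp del: One_nat_def)

lemma alt_forms_2: "alt_forms so3 2 = range two_form"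
proof (intro equalityI subsetI)
  fix \<omega> :: "(real ^ 3 ^ 3) list \<Rightarrow> real" assume \<omega>: "\<omega> \<in> alt_forms so3 2"
  have "linear (\<lambda>x. \<omega> [hat x, hat y])" for y
    using linear_alt_form_slot [of \<omega> "[]" "[hat y]"] \<omega> by (simp add: numeral_2_eq_2)
  moreover have "linear (\<lambda>y. \<omega> [hat x, hat y])" for x
    using linear_alt_form_slot [of \<omega> "[hat x]" "[]"] \<omega> by (simp add: numeral_2_eq_2)
  moreover have "\<omega> [hat x, hat x] = 0" for x
    using alt_form_repeated [OF \<omega>, of "[hat x, hat x]"] by simp
  ultimately obtain a where "\<And>x y. \<omega> [hat x, hat y] = a \<bullet> cross3 x y"
    using alternating_bilinear_eq_cross [of "\<lambda>x y. \<omega> [hat x, hat y]"] by blast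
  then have "\<omega> = two_form a"
    unfolding two_form_def using \<omega>
    by (intro eq_axial_formI) (auto simp: alt_form_outside length_Suc_conv numeral_2_eq_2)
  then show "\<omega> \<in> range two_form" by blast
qed (auto simp: two_form_alt)

text \<open>
  For a fixed first argument \<open>x\<close> the form is alternating bilinear in the other two, hence
  \<open>v x \<bullet> (y \<times> z)\<close> for some vector \<open>v x\<close>. Each component of \<open>v x\<close> is linear in \<open>x\<close> and vanishes on
  two of the three basis vectors, so that \<open>v x\<close> is a multiple of \<open>x\<close>; the factor is the same for all
  components because a form is invariant under cyclic permutations of its three arguments.
\<close>

lemma alt_forms_3: "alt_forms so3 3 = range three_form"
proof (intro equalityI subsetI)
  fix \<omega> :: "(real ^ 3 ^ 3) list \<Rightarrow> real" assume \<omega>: "\<omega> \<in> alt_forms so3 3"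
  let ?f = "\<lambda>x y z. \<omega> [hat x, hat y, hat z]"
  let ?e1 = "axis 1 1 :: real ^ 3" and ?e2 = "axis 2 1 :: real ^ 3" and ?e3 = "axis 3 1 :: real ^ 3"
  have l1: "linear (\<lambda>x. ?f x y z)" for y z
    using linear_alt_form_slot [of \<omega> "[]" "[hat y, hat z]"] \<omega> by (simp add: numeral_3_eq_3)
  have l2: "linear (\<lambda>y. ?f x y z)" for x z
    using linear_alt_form_slot [of \<omega> "[hat x]" "[hat z]"] \<omega> by (simp add: numeral_3_eq_3)
  have l3: "linear (\<lambda>z. ?f x y z)" for x y
    using linear_alt_form_slot [of \<omega> "[hat x, hat y]" "[]"] \<omega> by (simp add: numeral_3_eq_3)
  have alt: "?f x x z = 0" "?f x z x = 0" "?f z x x = 0" for x z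
    using alt_form_repeated [OF \<omega>] by simp_all
  have cross: "?f x y z = vector [?f x ?e2 ?e3, ?f x ?e3 ?e1, ?f x ?e1 ?e2] \<bullet> cross3 y z" for x y z
    by (rule alternating_bilinear_eq_cross [of "?f x", OF l2 l3 alt(3)])
  have skew: "?f x y z = - ?f y x z" for x y z
  proof -
    have "?f (x + y) (x + y) z = ?f x y z + ?f y x z"
      by (simp only: linear_add [OF l1] linear_add [OF l2]) (simp add: alt)
    then show ?thesis
      by (simp add: alt)
  qed
  have skew': "?f x y z = - ?f x z y" for x y z
  proof -
    have "?f x (y + z) (y + z) = ?f x y z + ?f x z y"
      by (simp only: linear_add [OF l2] linear_add [OF l3]) (simp add: alt)
    then show ?thesis
      by (simp add: alt)
  qed
  define c where "c = ?f ?e1 ?e2 ?e3"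
  have cyclic: "?f ?e1 ?e2 ?e3 = c" "?f ?e2 ?e3 ?e1 = c" "?f ?e3 ?e1 ?e2 = c"
    using skew' [of ?e2 ?e3 ?e1] skew [of ?e2 ?e1 ?e3] skew [of ?e3 ?e1 ?e2] skew' [of ?e1 ?e3 ?e2]
    unfolding c_def by linarith+
  have coeffs: "?f x ?e2 ?e3 = c * x $ 1" "?f x ?e3 ?e1 = c * x $ 2" "?f x ?e1 ?e2 = c * x $ 3" for x
    using linear_functional_eq_inner [OF l1, of x ?e2 ?e3]
      linear_functional_eq_inner [OF l1, of x ?e3 ?e1]
      linear_functional_eq_inner [OF l1, of x ?e1 ?e2]
    by (simp_all add: inner_vec_def sum_3 alt cyclic)
  have "?f x y z = c * (x \<bullet> cross3 y z)" for x y z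
    unfolding cross [of x y z] coeffs by (simp add: inner_vec_def sum_3 algebra_simps)
  then have "\<omega> = three_form c"
    unfolding three_form_def using \<omega>
    by (intro eq_axial_formI)
      (auto simp: alt_form_outside length_Suc_conv numeral_3_eq_3 numeral_2_eq_2)
  then show "\<omega> \<in> range three_form" by blast
qed (auto simp: three_form_alt)


section \<open>The differential in coordinates\<close>

lemma form_diff_outside: "As \<notin> tuples g (Suc k) \<Longrightarrow> form_diff g br k \<omega> As = 0"
  by (simp add: form_diff_def)

text \<open>
  The differential of a 0-form is a sum over no pairs of indices.
\<close>

lemma form_diff_degree_0: "form_diff so3 commutator 0 \<omega> = (\<lambda>_. 0)"
  by (simp add: form_diff_def fun_eq_iff)

lemma form_diff_one_form_eq: "form_diff so3 commutator 1 (one_form a) = two_form (- a)"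
  unfolding two_form_def
proof (rule eq_axial_formI)
  show "form_diff so3 commutator 1 (one_form a) As = 0" if "As \<notin> tuples so3 2" for As
    using that by (simp add: form_diff_outside numeral_2_eq_2)
  show "form_diff so3 commutator 1 (one_form a) (map hat xs) = - a \<bullet> cross3 (xs ! 0) (xs ! 1)"
    if len: "length xs = 2" for xs
  proof -
    obtain x y where "xs = [x, y]"
      using len by (auto simp: length_Suc_conv numeral_2_eq_2)
    then show ?thesis
      by (simp add: form_diff_one_form commutator_hat one_form_def axial_form_def tuples_def
          del: One_nat_def)
  qed
qed

text \<open>
  The three terms add up to \<open>- a\<close> paired with the Jacobi sum of the cross product.
\<close>

lemma form_diff_two_form_eq: "form_diff so3 commutator 2 (two_form a) = (\<lambda>_. 0)"
proof -
  have "form_diff so3 commutator 2 (two_form a) = axial_form 3 (\<lambda>_. 0)"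
  proof (rule eq_axial_formI)
    show "form_diff so3 commutator 2 (two_form a) As = 0" if "As \<notin> tuples so3 3" for As
      using that by (simp add: form_diff_outside numeral_3_eq_3 numeral_2_eq_2)
    show "form_diff so3 commutator 2 (two_form a) (map hat xs) = 0" if len: "length xs = 3" for xs
    proof -
      obtain x y z where xs: "xs = [x, y, z]"
        using len by (auto simp: length_Suc_conv numeral_3_eq_3)
      have "form_diff so3 commutator 2 (two_form a) (map hat xs) =
          - (a \<bullet> cross3 (cross3 x y) z) + a \<bullet> cross3 (cross3 x z) y - a \<bullet> cross3 (cross3 y z) x"
        by (simp add: xs form_diff_def two_form_def axial_form_def tuples_def commutator_hat
            nths_Cons numeral_2_eq_2 numeral_3_eq_3 lessThan_Suc atMost_Suc)
      also have "\<dots> = 0"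
        by (simp add: inner_vec_def sum_3 cross_components algebra_simps)
      finally show ?thesis .
    qed
  qed
  then show ?thesis by (simp add: axial_form_def fun_eq_iff)
qed

text \<open>
  The six terms are products \<open>(x \<times> y) \<bullet> (z \<times> w)\<close>. Each splitting of the four vectors into two
  pairs occurs twice, and what remains is twice the identity
  \<open>(x \<times> y) \<bullet> (z \<times> w) - (x \<times> z) \<bullet> (y \<times> w) + (x \<times> w) \<bullet> (y \<times> z) = 0\<close>, which follows from the formula
  \<open>(x \<times> y) \<bullet> (z \<times> w) = (x \<bullet> z) (y \<bullet> w) - (x \<bullet> w) (y \<bullet> z)\<close>.
\<close>

lemma form_diff_three_form_eq: "form_diff so3 commutator 3 (three_form c) = (\<lambda>_. 0)"
proof -
  have "form_diff so3 commutator 3 (three_form c) = axial_form 4 (\<lambda>_. 0)"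
  proof (rule eq_axial_formI)
    show "form_diff so3 commutator 3 (three_form c) As = 0" if "As \<notin> tuples so3 4" for As
      using that by (simp add: form_diff_outside eval_nat_numeral)
    show "form_diff so3 commutator 3 (three_form c) (map hat xs) = 0" if len: "length xs = 4" for xs
    proof -
      obtain x y z w where xs: "xs = [x, y, z, w]"
        using len by (auto simp: length_Suc_conv eval_nat_numeral)
      have "form_diff so3 commutator 3 (three_form c) (map hat xs) =
          c * (- (cross3 x y \<bullet> cross3 z w) + cross3 x z \<bullet> cross3 y w - cross3 y z \<bullet> cross3 x w
            - cross3 x w \<bullet> cross3 y z + cross3 y w \<bullet> cross3 x z - cross3 z w \<bullet> cross3 x y)"
        by (simp add: xs form_diff_def three_form_def axial_form_def tuples_def commutator_hat
            nths_Cons eval_nat_numeral lessThan_Suc atMost_Suc algebra_simps)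
      also have "\<dots> = 0"
        by (simp add: inner_vec_def sum_3 cross_components algebra_simps)
      finally show ?thesis .
    qed
  qed
  then show ?thesis by (simp add: axial_form_def fun_eq_iff)
qed


section \<open>Cohomology\<close>

lemma cocycles_0: "cocycles so3 commutator 0 = alt_forms so3 0"
  by (simp add: cocycles_def form_diff_degree_0)

lemma coboundaries_1: "coboundaries so3 commutator 1 = {\<lambda>_. 0}"
  using alt_forms_zero [of so3 0] by (auto simp: form_diff_degree_0)

text \<open>
  A closed 1-form vanishes on all brackets, and every element of \<open>so3\<close> is a sum of brackets.
\<close>

lemma cocycles_1: "cocycles so3 commutator 1 = {\<lambda>_. 0}"
proof (intro equalityI subsetI)
  fix \<omega> assume "\<omega> \<in> cocycles so3 commutator 1"
  then obtain a where a: "\<omega> = one_form a" "two_form (- a) = (\<lambda>_. 0)"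
    unfolding cocycles_def alt_forms_1 using form_diff_one_form_eq by auto
  have "a \<bullet> cross3 x y = 0" for x y
    using fun_cong [OF a(2), of "[hat x, hat y]"]
    by (simp add: two_form_def axial_form_def tuples_def)
  from this [of "axis 2 1" "axis 3 1"] this [of "axis 3 1" "axis 1 1"] this [of "axis 1 1" "axis 2 1"]
  have "a = 0"
    by (simp add: cross_basis inner_axis vec_eq_iff forall_3)
  with a show "\<omega> \<in> {\<lambda>_. 0}"
    by (simp add: one_form_def axial_form_def fun_eq_iff)
next
  fix \<omega> :: "(real ^ 3 ^ 3) list \<Rightarrow> real" assume "\<omega> \<in> {\<lambda>_. 0}"
  moreover have "form_diff so3 commutator 1 (\<lambda>_. 0) = (\<lambda>_. 0)"
    by (simp add: form_diff_def fun_eq_iff)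
  ultimately show "\<omega> \<in> cocycles so3 commutator 1"
    using alt_forms_zero [of so3 1] by (simp add: cocycles_def del: One_nat_def)
qed

lemma cocycles_2: "cocycles so3 commutator 2 = alt_forms so3 2"
  unfolding cocycles_def alt_forms_2 by (auto simp: form_diff_two_form_eq)

lemma coboundaries_2: "coboundaries so3 commutator 2 = alt_forms so3 2"
proof -
  have "coboundaries so3 commutator 2 = form_diff so3 commutator 1 ` alt_forms so3 1"
    by (simp add: numeral_2_eq_2)
  also have "\<dots> = range (\<lambda>a. two_form (- a))"
    unfolding alt_forms_1 image_image form_diff_one_form_eq ..
  also have "\<dots> = alt_forms so3 2"
    unfolding alt_forms_2 by (auto intro: rangeI image_eqI [of _ _ "- a" for a])
  finally show ?thesis .
qed

lemma cocycles_3: "cocycles so3 commutator 3 = alt_forms so3 3"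
  unfolding cocycles_def alt_forms_3 by (auto simp: form_diff_three_form_eq)

lemma coboundaries_3: "coboundaries so3 commutator 3 = {\<lambda>_. 0}"
proof -
  have "coboundaries so3 commutator 3 = form_diff so3 commutator 2 ` alt_forms so3 2"
    by (simp add: numeral_3_eq_3 numeral_2_eq_2)
  also have "\<dots> = {\<lambda>_. 0}"
    unfolding alt_forms_2 image_image form_diff_two_form_eq by simp
  finally show ?thesis .
qed

lemma const_form_Nil: "const_form c [] = c"
  by (simp add: const_form_def axial_form_def tuples_def)

lemma three_form_basis:
  "three_form c [hat (axis 1 1), hat (axis 2 1), hat (axis 3 1)] = c"
  by (simp add: three_form_def axial_form_def tuples_def cross_basis inner_axis_axis)

lemma const_form_zero: "const_form 0 = (\<lambda>_. 0)"
  by (simp add: const_form_def axial_form_def fun_eq_iff)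

lemma three_form_zero: "three_form 0 = (\<lambda>_. 0)"
  by (simp add: three_form_def axial_form_def fun_eq_iff)

text \<open>
  Here \<open>F\<close> parametrizes the forms by a real number, which the value at \<open>As\<close> recovers; evaluation
  at \<open>As\<close> is then a functional on the cocycles with trivial kernel and range \<open>\<real>\<close>.
\<close>

lemma cohomology_line:
  assumes forms: "cocycles g br k = alt_forms g k" "coboundaries g br k = {\<lambda>_. 0}"
    and range: "alt_forms g k = range F" and zero: "F 0 = (\<lambda>_. 0)" and eval: "\<And>c. F c As = c"
  shows "vs_isomorphic (lie_cohomology g br k) real_line"
proof -
  have ev: "(\<lambda>\<omega>. \<omega> As) ` alt_forms g k = UNIV"
    by (auto simp: range image_image eval)
  have "vs_isomorphic (quotient_module (function_space (alt_forms g k)) {\<lambda>_. 0})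
      (real_line\<lparr>carrier := (\<lambda>\<omega>. \<omega> As) ` alt_forms g k\<rparr>)"
  proof (rule quotient_by_kernel)
    show "{\<lambda>_. 0} = {\<omega> \<in> alt_forms g k. \<omega> As = 0}"
      using alt_forms_zero [of g k] by (auto simp: range eval zero)
  qed (auto simp: alt_forms_zero alt_forms_add alt_forms_scale)
  then show ?thesis
    by (simp add: lie_cohomology_def forms ev real_line_carrier_UNIV)
qed

lemma cohomology_zero:
  assumes eq: "coboundaries g br k = cocycles g br k"
    and zero: "(\<lambda>_. 0) \<in> cocycles g br k"
    and add: "\<And>f h. \<lbrakk>f \<in> cocycles g br k; h \<in> cocycles g br k\<rbrakk> \<Longrightarrow> (\<lambda>x. f x + h x) \<in> cocycles g br k"
    and scale: "\<And>c f. f \<in> cocycles g br k \<Longrightarrow> (\<lambda>x. c * f x) \<in> cocycles g br k"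
  shows "vs_isomorphic (lie_cohomology g br k) zero_space"
proof -
  have "vs_isomorphic (quotient_module (function_space (cocycles g br k)) (cocycles g br k))
      (real_line\<lparr>carrier := (\<lambda>_. 0) ` cocycles g br k\<rparr>)"
    by (rule quotient_by_kernel) (auto intro: zero add scale)
  moreover have "(\<lambda>_. 0 :: real) ` cocycles g br k = {0}"
    using zero by auto
  ultimately show ?thesis
    by (simp add: lie_cohomology_def eq real_line_carrier_zero)
qed

theorem theorem27:
  shows "vs_isomorphic (lie_cohomology so3 commutator 0) real_line
    \<and> vs_isomorphic (lie_cohomology so3 commutator 1) zero_space
    \<and> vs_isomorphic (lie_cohomology so3 commutator 2) zero_space
    \<and> vs_isomorphic (lie_cohomology so3 commutator 3) real_line"
proof (intro conjI)
  show "vs_isomorphic (lie_cohomology so3 commutator 0) real_line"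
    by (rule cohomology_line [OF cocycles_0 _ alt_forms_0 const_form_zero const_form_Nil]) simp
  show "vs_isomorphic (lie_cohomology so3 commutator 1) zero_space"
    by (rule cohomology_zero) (simp_all only: cocycles_1 coboundaries_1, simp_all)
  show "vs_isomorphic (lie_cohomology so3 commutator 2) zero_space"
    by (rule cohomology_zero)
      (simp_all add: cocycles_2 coboundaries_2 alt_forms_zero alt_forms_add alt_forms_scale)
  show "vs_isomorphic (lie_cohomology so3 commutator 3) real_line"
    by (rule cohomology_line
        [OF cocycles_3 coboundaries_3 alt_forms_3 three_form_zero three_form_basis])
qed

end
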